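(* Let $M,K,L$ be real $n\times n$ matrices with $M$ and $L$ invertible and $M$ and $K$ symmetric, and consider on $\mathbb{R}^n\times\mathbb{R}^n$ the quadratic left discrete Hamiltonian $$H_{\rm d}^{-}(p_k,q_{k+1})=\tfrac12 p_k^{T}M^{-1}p_k+p_k^{T}Lq_{k+1}+\tfrac12 q_{k+1}^{T}Kq_{k+1},$$ whose left discrete Hamilton's equations are the discrete linear Hamiltonian system $$\begin{pmatrix} q_{k+1}\\ p_{k+1}\end{pmatrix}=\begin{pmatrix}-L^{-1}&-L^{-1}M^{-1}\\ KL^{-1}&KL^{-1}M^{-1}-L^{T}\end{pmatrix}\begin{pmatrix} q_{k}\\ p_{k}\end{pmatrix}.$$ Let $S_{\rm d}^{k}(q)=\tfrac12 q^{T}A_kq+b_k^{T}q+c_k$, with $A_k$ real symmetric $n\times n$ matrices, $b_k\in\mathbb{R}^n$, $c_k\in\mathbb{R}$, and suppose that $I+A_kM^{-1}$ is invertible for each $k$. If the functions $S_{\rm d}^k$ satisfy the left discrete Hamilton--Jacobi equation $$S_{\rm d}^{k+1}(f^{-}_{k}(q))-S_{\rm d}^{k}(q)+DS_{\rm d}^{k}(q)\cdot q+H_{\rm d}^{-}\big(DS_{\rm d}^{k}(q),f^{-}_{k}(q)\big)=0\qquad\text{for all }q\in\mathbb{R}^n \text{ and all } k,$$ where $f_k^-:\mathbb{R}^n\to\mathbb{R}^n$ is defined implicitly by $q=-D_1H_{\rm d}^{-}\big(DS_{\rm d}^{k}(q),f_k^{-}(q)\big)$, then the matrices $A_k$ satisfy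 the discrete Riccati equation $$A_{k+1}=\left[KL^{-1}+(KL^{-1}M^{-1}-L^{T})A_k\right]\left(-L^{-1}-L^{-1}M^{-1}A_k\right)^{-1}\qquad\text{for all }k.$$
   Context: $D_i$ denotes the derivative in the $i$-th argument and $D$ the derivative of a function of one argument. The left discrete Hamilton's equations of $H_{\rm d}^-$ are $q_k=-D_1H_{\rm d}^{-}(p_k,q_{k+1})$, $p_{k+1}=-D_2H_{\rm d}^{-}(p_k,q_{k+1})$. The index $k$ runs over the discrete times under consideration. *)

theory Defs
  imports "HOL-Analysis.Analysis"
begin

text \<open>
  Covectors on a Euclidean space are identified with vectors through the inner product, so that
  derivatives of scalar functions are gradients (unique where they exist).
\<close>

definition grad :: "('a::real_inner \<Rightarrow> real) \<Rightarrow> 'a \<Rightarrow> 'a" where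
  "grad f x = (THE g. GDERIV f x :> g)"

definition D1 :: "('a::real_inner \<Rightarrow> 'b \<Rightarrow> real) \<Rightarrow> 'a \<Rightarrow> 'b \<Rightarrow> 'a" where
  "D1 H x y = grad (\<lambda>u. H u y) x"

definition D2 :: "('a \<Rightarrow> 'b::real_inner \<Rightarrow> real) \<Rightarrow> 'a \<Rightarrow> 'b \<Rightarrow> 'b" where
  "D2 H x y = grad (\<lambda>v. H x v) y"

text \<open>One step \<open>(q, p) \<mapsto> (q', p')\<close> of the left discrete Hamilton's equations of \<open>H\<close>.\<close>

definition left_hamilton_eqs ::
    "('a::real_inner \<Rightarrow> 'a \<Rightarrow> real) \<Rightarrow> 'a \<Rightarrow> 'a \<Rightarrow> 'a \<Rightarrow> 'a \<Rightarrow> bool" where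
  "left_hamilton_eqs H q p q' p' \<longleftrightarrow> q = - D1 H p q' \<and> p' = - D2 H p q'"

definition quad_left_hamiltonian ::
    "real^'n^'n \<Rightarrow> real^'n^'n \<Rightarrow> real^'n^'n \<Rightarrow> real^'n \<Rightarrow> real^'n \<Rightarrow> real" where
  "quad_left_hamiltonian M K L p q' =
     1/2 * (p \<bullet> (matrix_inv M *v p)) + p \<bullet> (L *v q') + 1/2 * (q' \<bullet> (K *v q'))"

definition quad_fun :: "real^'n^'n \<Rightarrow> real^'n \<Rightarrow> real \<Rightarrow> real^'n \<Rightarrow> real" where
  "quad_fun A b c q = 1/2 * (q \<bullet> (A *v q)) + b \<bullet> q + c"

end

theory Submission
  imports Defs
begin

text \<open>
  Differentiating the Hamilton--Jacobi equation in \<open>q\<close>, the defining equation of \<open>f\<^sub>k\<close> cancels every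
  term except \<open>N\<^sup>T (D S\<^sub>k\<^sub>+\<^sub>1 (f\<^sub>k q) + D\<^sub>2 H (D S\<^sub>k q, f\<^sub>k q)) = 0\<close>, where \<open>N = - L\<^sup>-\<^sup>1 (1 + M\<^sup>-\<^sup>1 A\<^sub>k)\<close> is the
  linear part of \<open>f\<^sub>k\<close>. Since \<open>N\<close> is invertible (\<open>1 + M\<^sup>-\<^sup>1 A\<^sub>k\<close> is the transpose of
  \<open>1 + A\<^sub>k M\<^sup>-\<^sup>1\<close>), the bracket vanishes; it is affine in \<open>q\<close>, and its linear part is the Riccati
  equation.
\<close>

text \<open>This rule would turn \<open>transpose B *v x\<close> into \<open>x v* B\<close>;
  gradients below keep the form with \<open>transpose\<close>.\<close>

declare transpose_matrix_vector [simp del]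

lemma matrix_inv_mult:
  fixes A :: "'a::semiring_1^'n^'m"
  assumes "invertible A"
  shows matrix_inv_right: "A ** matrix_inv A = mat 1"
    and matrix_inv_left: "matrix_inv A ** A = mat 1"
  using someI_ex[of "\<lambda>A'. A ** A' = mat 1 \<and> A' ** A = mat 1"] assms
  unfolding matrix_inv_def invertible_def by auto

lemma matrix_vector_mult_eq_iff:
  fixes A :: "'a::semiring_1^'n^'m"
  assumes "invertible A"
  shows "A *v x = y \<longleftrightarrow> x = matrix_inv A *v y"
  by (auto simp: matrix_vector_mul_assoc matrix_inv_mult[OF assms])

lemma matrix_vector_mult_minus: "(B :: real^'n^'m) *v (- x) = - (B *v x)"
  using vec.neg by blast

lemma matrix_vector_mult_minus_left: "(- B :: real^'n^'m) *v x = - (B *v x)"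
  by (simp add: vec_eq_iff matrix_vector_mult_def sum_negf)

text \<open>Together with \<open>matrix_eq\<close>, these reduce matrix identities to vector
  identities: products become nested applications and signs move outward.\<close>

lemmas matrix_vector_simps =
  matrix_vector_mult_minus matrix_vector_mult_minus_left matrix_vector_mul_assoc[symmetric]

lemma inner_matrix_vector_transpose:
  fixes B :: "real^'n^'m"
  shows "x \<bullet> (B *v y) = (transpose B *v x) \<bullet> y"
  by (simp add: transpose_matrix_vector dot_lmul_matrix)

lemma has_derivative_matrix_vector_mult [derivative_intros]:
  fixes B :: "real^'n^'m"
  assumes "(u has_derivative u') F"
  shows "((\<lambda>x. B *v u x) has_derivative (\<lambda>h. B *v u' h)) F"
  using bounded_linear.has_derivative[OF matrix_vector_mul_bounded_linear assms] .

text \<open>Transposing \<open>M ** matrix_inv M = mat 1\<close> gives a left inverse of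
  \<open>M\<close>, which must agree with the right inverse.\<close>

lemma matrix_inv_symmetric:
  fixes M :: "real^'n^'n"
  assumes "invertible M" "transpose M = M"
  shows "transpose (matrix_inv M) = matrix_inv M"
proof -
  have "transpose (matrix_inv M) ** M = mat 1"
    using matrix_transpose_mul[of M "matrix_inv M"] assms by (simp add: matrix_inv_right)
  then have "transpose (matrix_inv M) ** M ** matrix_inv M = matrix_inv M"
    by simp
  then show ?thesis
    by (simp add: matrix_inv_right[OF assms(1)] flip: matrix_mul_assoc)
qed

text \<open>The description in \<open>grad\<close> is unique: two gradients at \<open>x\<close> have
  the same inner product with every vector.\<close>

lemma grad_eqI:
  assumes "(f has_derivative (\<lambda>h. g \<bullet> h)) (at x)"
  shows "grad f x = g"
proof -
  have g: "GDERIV f x :> g"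
    using assms by (simp add: gderiv_def inner_commute)
  have "g' = g" if g': "GDERIV f x :> g'" for g'
  proof -
    have "h \<bullet> g' = h \<bullet> g" for h
      using has_derivative_unique[OF g'[unfolded gderiv_def] g[unfolded gderiv_def]]
      by (rule fun_cong)
    then show ?thesis
      using vector_eq_ldot[of g' g] by blast
  qed
  with g show ?thesis
    unfolding grad_def by (rule the_equality)
qed

text \<open>Symmetry merges the two product-rule terms of the quadratic part. The inner function
  \<open>u\<close> allows differentiation along \<open>f\<close> as well as at a point.\<close>

lemma has_derivative_quad_fun:
  fixes A :: "real^'n^'n"
  assumes "transpose A = A" "(u has_derivative u') (at x)"
  shows "((\<lambda>x. quad_fun A b c (u x)) has_derivative (\<lambda>h. (A *v u x + b) \<bullet> u' h)) (at x)"
  unfolding quad_fun_def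
  using inner_matrix_vector_transpose[of "u x" A] assms(1)
  by (auto intro!: derivative_eq_intros assms(2)
    simp: fun_eq_iff inner_add_left inner_commute[of "u' _"])

text \<open>Chain rule for both arguments at once: the coefficient vectors are the two partial
  gradients. Freezing \<open>u\<close> or \<open>v\<close> gives \<open>D2\<close> or
  \<open>D1\<close>; moving both serves the Hamilton--Jacobi equation.\<close>

lemma has_derivative_quad_left_hamiltonian:
  fixes M K L :: "real^'n^'n"
  assumes M: "invertible M" "transpose M = M" and K: "transpose K = K"
    and u: "(u has_derivative u') (at x)" and v: "(v has_derivative v') (at x)"
  shows "((\<lambda>x. quad_left_hamiltonian M K L (u x) (v x)) has_derivative
    (\<lambda>h. (matrix_inv M *v u x + L *v v x) \<bullet> u' h + (transpose L *v u x + K *v v x) \<bullet> v' h)) (at x)"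
  unfolding quad_left_hamiltonian_def
  using inner_matrix_vector_transpose[of "u x" "matrix_inv M"]
    inner_matrix_vector_transpose[of "u x" L] inner_matrix_vector_transpose[of "v x" K]
    matrix_inv_symmetric[OF M] K
  by (auto intro!: derivative_eq_intros u v
    simp: fun_eq_iff inner_add_left inner_commute[of "u' _"] inner_commute[of "v' _"])

lemma grad_quad_fun:
  fixes A :: "real^'n^'n"
  assumes "transpose A = A"
  shows "grad (quad_fun A b c) q = A *v q + b"
  using has_derivative_quad_fun[OF assms has_derivative_ident] by (rule grad_eqI)

lemma D1_quad_left_hamiltonian:
  fixes M K L :: "real^'n^'n"
  assumes "invertible M" "transpose M = M" "transpose K = K"
  shows "D1 (quad_left_hamiltonian M K L) p q = matrix_inv M *v p + L *v q"
  unfolding D1_def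
  using has_derivative_quad_left_hamiltonian[OF assms has_derivative_ident has_derivative_const]
  by (intro grad_eqI) simp

lemma D2_quad_left_hamiltonian:
  fixes M K L :: "real^'n^'n"
  assumes "invertible M" "transpose M = M" "transpose K = K"
  shows "D2 (quad_left_hamiltonian M K L) p q = transpose L *v p + K *v q"
  unfolding D2_def
  using has_derivative_quad_left_hamiltonian[OF assms has_derivative_const has_derivative_ident]
  by (intro grad_eqI) simp

text \<open>Used twice: with free \<open>p\<close> for Hamilton's equations, and with
  \<open>p\<close> the gradient of the generating function to make \<open>f\<close>
  explicit.\<close>

lemma implicit_step_iff:
  fixes L W :: "real^'n^'n"
  assumes "invertible L"
  shows "q = - (W *v p + L *v q') \<longleftrightarrow>
    q' = (- matrix_inv L) *v q + (- (matrix_inv L ** W)) *v p"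
proof -
  have "q = - (W *v p + L *v q') \<longleftrightarrow> L *v q' = - (q + W *v p)"
    unfolding eq_neg_iff_add_eq_0 by (simp only: ac_simps)
  also have "\<dots> \<longleftrightarrow> q' = matrix_inv L *v (- (q + W *v p))"
    by (rule matrix_vector_mult_eq_iff[OF assms])
  also have "\<dots> \<longleftrightarrow> q' = (- matrix_inv L) *v q + (- (matrix_inv L ** W)) *v p"
    by (simp add: algebra_simps matrix_vector_simps)
  finally show ?thesis .
qed

lemma left_hamilton_eqs_quad_left_hamiltonian:
  fixes M K L :: "real^'n^'n"
  assumes "invertible M" "transpose M = M" "transpose K = K" "invertible L"
  shows "left_hamilton_eqs (quad_left_hamiltonian M K L) q p q' p' \<longleftrightarrow>
    q' = (- matrix_inv L) *v q + (- (matrix_inv L ** matrix_inv M)) *v p \<and>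
    p' = (K ** matrix_inv L) *v q + (K ** matrix_inv L ** matrix_inv M - transpose L) *v p"
proof -
  have "- (transpose L *v p + K *v ((- matrix_inv L) *v q + (- (matrix_inv L ** matrix_inv M)) *v p))
      = (K ** matrix_inv L) *v q + (K ** matrix_inv L ** matrix_inv M - transpose L) *v p"
    by (simp add: algebra_simps matrix_vector_simps)
  then show ?thesis
    unfolding left_hamilton_eqs_def D1_quad_left_hamiltonian[OF assms(1-3)]
      D2_quad_left_hamiltonian[OF assms(1-3)] implicit_step_iff[OF assms(4)] by auto
qed

text \<open>The matrix factors as \<open>- matrix_inv L ** (mat 1 + matrix_inv M ** A)\<close>. Its
  invertibility makes the inverse in the Riccati equation a genuine one.\<close>

lemma invertible_step_matrix:
  fixes M L A :: "real^'n^'n"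
  assumes "invertible M" "transpose M = M" "invertible L" "transpose A = A"
    "invertible (mat 1 + A ** matrix_inv M)"
  shows "invertible (- matrix_inv L - matrix_inv L ** matrix_inv M ** A)"
proof -
  have "transpose (mat 1 + A ** matrix_inv M) = mat 1 + matrix_inv M ** A"
    using assms matrix_transpose_mul[of A "matrix_inv M"] matrix_inv_symmetric[OF assms(1,2)]
    by (simp add: transpose_def vec_eq_iff mat_def)
  then have "invertible (mat 1 + matrix_inv M ** A)"
    using transpose_invertible[OF assms(5)] by simp
  moreover have "invertible (matrix_inv L)"
    unfolding invertible_def using matrix_inv_mult[OF assms(3)] by blast
  ultimately have "invertible (matrix_inv L ** (mat 1 + matrix_inv M ** A))"
    by (rule invertible_mult[rotated])
  then have "invertible ((- 1) *\<^sub>R (matrix_inv L ** (mat 1 + matrix_inv M ** A)))"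
    by (intro scalar_invertible) simp_all
  moreover have "(- 1) *\<^sub>R (matrix_inv L ** (mat 1 + matrix_inv M ** A))
      = - matrix_inv L - matrix_inv L ** matrix_inv M ** A"
    by (simp add: matrix_eq matrix_vector_simps algebra_simps)
  ultimately show ?thesis
    by simp
qed

text \<open>Evaluating at \<open>0\<close> identifies the constants, which then cancel.\<close>

lemma affine_matrix_eqD:
  fixes B C :: "real^'n^'m"
  assumes "\<And>q. B *v q + d = C *v q + e"
  shows "B = C"
proof -
  have "d = e" using assms[of 0] by simp
  then show ?thesis using assms by (simp add: matrix_eq)
qed

lemma riccati_step:
  fixes M K L A A' :: "real^'n^'n"
  assumes M: "invertible M" "transpose M = M" and K: "transpose K = K" and L: "invertible L"
    and A: "transpose A = A" "transpose A' = A'"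
    and inv: "invertible (mat 1 + A ** matrix_inv M)"
    and f: "\<And>q. q = - D1 (quad_left_hamiltonian M K L) (A *v q + b) (f q)"
    and HJ: "\<And>q. quad_fun A' b' c' (f q) - quad_fun A b c q + (A *v q + b) \<bullet> q
      + quad_left_hamiltonian M K L (A *v q + b) (f q) = 0"
  defines "N \<equiv> - matrix_inv L - matrix_inv L ** matrix_inv M ** A"
  shows "A' = (K ** matrix_inv L + (K ** matrix_inv L ** matrix_inv M - transpose L) ** A)
    ** matrix_inv N"
proof -
  define d where "d = - (matrix_inv L *v (matrix_inv M *v b))"
  let ?p = "\<lambda>q. A *v q + b"
  have f_implicit: "matrix_inv M *v ?p q + L *v f q = - q" for q
    using f[of q] equation_minus_iff unfolding D1_quad_left_hamiltonian[OF M K] by blast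
  \<comment> \<open>Only the implicit equation for \<open>f\<close> is assumed; solving it shows
    that \<open>f\<close> is affine, hence differentiable.\<close>
  have f_eq: "f q = N *v q + d" for q
    using f[of q]
    unfolding D1_quad_left_hamiltonian[OF M K] implicit_step_iff[OF L] N_def d_def
    by (simp add: algebra_simps matrix_vector_simps)
  have N: "invertible N"
    unfolding N_def using M L A(1) inv by (rule invertible_step_matrix)
  have p': "(?p has_derivative (\<lambda>h. A *v h)) (at q)" for q
    by (auto intro!: derivative_eq_intros)
  have f': "(f has_derivative (\<lambda>h. N *v h)) (at q)" for q
    unfolding f_eq[abs_def] by (auto intro!: derivative_eq_intros)
  \<comment> \<open>The terms \<open>?p q \<bullet> h\<close> from the second and third summands
    cancel. The remaining \<open>(A *v h) \<bullet> q\<close> cancels against the \<open>D1\<close>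
    term of the Hamiltonian, which is \<open>- q\<close> by \<open>f_implicit\<close>.\<close>
  have "((\<lambda>q. quad_fun A' b' c' (f q) - quad_fun A b c q + ?p q \<bullet> q
      + quad_left_hamiltonian M K L (?p q) (f q)) has_derivative
      (\<lambda>h. (A' *v f q + b' + (transpose L *v ?p q + K *v f q)) \<bullet> (N *v h))) (at q)" for q
    by (auto intro!: derivative_eq_intros has_derivative_quad_fun[OF A(2)]
        has_derivative_quad_fun[OF A(1)] has_derivative_quad_left_hamiltonian[OF M K] p' f'
      simp: fun_eq_iff f_implicit inner_add_left inner_commute[of q])
  then have "((\<lambda>q. 0::real) has_derivative
      (\<lambda>h. (A' *v f q + b' + (transpose L *v ?p q + K *v f q)) \<bullet> (N *v h))) (at q)" for q
    unfolding HJ .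
  then have "(A' *v f q + b' + (transpose L *v ?p q + K *v f q)) \<bullet> (N *v h) = 0" for q h
    by (rule fun_cong[OF has_derivative_unique[OF _ has_derivative_const]])
  \<comment> \<open>Since \<open>N\<close> is onto, the bracket is orthogonal to every
    vector.\<close>
  then have "(A' *v f q + b' + (transpose L *v ?p q + K *v f q)) \<bullet> (N *v (matrix_inv N *v h)) = 0" for q h
    by simp
  then have "(A' *v f q + b' + (transpose L *v ?p q + K *v f q)) \<bullet> h = 0" for q h
    by (simp add: matrix_vector_mul_assoc matrix_inv_right[OF N])
  then have "A' *v f q + b' + (transpose L *v ?p q + K *v f q) = 0" for q
    using inner_eq_zero_iff by blast
  then have "(A' ** N) *v q + (A' *v d + b') =
      (- (transpose L ** A) - K ** N) *v q + (- (transpose L *v b) - K *v d)" for q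
    unfolding f_eq
    by (simp add: eq_neg_iff_add_eq_0 algebra_simps matrix_vector_simps)
  then have "A' ** N = - (transpose L ** A) - K ** N"
    by (rule affine_matrix_eqD)
  \<comment> \<open>Expanding \<open>N\<close> in \<open>- K ** N\<close> yields the two terms
    containing \<open>K ** matrix_inv L\<close>.\<close>
  also have "\<dots> = K ** matrix_inv L + (K ** matrix_inv L ** matrix_inv M - transpose L) ** A"
    by (simp add: matrix_eq N_def algebra_simps matrix_vector_simps)
  finally have "A' ** N ** matrix_inv N = \<dots> ** matrix_inv N"
    by (rule arg_cong)
  then show ?thesis
    by (simp add: matrix_inv_right[OF N] flip: matrix_mul_assoc)
qed

theorem proposition5p4:
  fixes M K L :: "real^'n^'n"
    and T :: "int set"  \<comment> \<open>the discrete times under consideration; \<open>k\<close> is a step when \<open>k, k + 1 \<in> T\<close>\<close>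
    and A :: "int \<Rightarrow> real^'n^'n" and b :: "int \<Rightarrow> real^'n" and c :: "int \<Rightarrow> real"
    and H :: "real^'n \<Rightarrow> real^'n \<Rightarrow> real"
    and S :: "int \<Rightarrow> real^'n \<Rightarrow> real"
    and f :: "int \<Rightarrow> real^'n \<Rightarrow> real^'n"
  assumes "invertible M" and "invertible L"
    and "transpose M = M" and "transpose K = K"
    and H: "H = quad_left_hamiltonian M K L"
    and A_sym: "\<And>k. k \<in> T \<Longrightarrow> transpose (A k) = A k"
    and S: "\<And>k. k \<in> T \<Longrightarrow> S k = quad_fun (A k) (b k) (c k)"
    and inv: "\<And>k. k \<in> T \<Longrightarrow> k + 1 \<in> T \<Longrightarrow> invertible (mat 1 + A k ** matrix_inv M)"
    and f: "\<And>k q. k \<in> T \<Longrightarrow> k + 1 \<in> T \<Longrightarrow> q = - D1 H (grad (S k) q) (f k q)"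
    and HJ: "\<And>k q. k \<in> T \<Longrightarrow> k + 1 \<in> T \<Longrightarrow>
      S (k + 1) (f k q) - S k q + grad (S k) q \<bullet> q + H (grad (S k) q) (f k q) = 0"
  shows "(\<forall>q p q' p'. left_hamilton_eqs H q p q' p' \<longleftrightarrow>
            q' = (- matrix_inv L) *v q + (- (matrix_inv L ** matrix_inv M)) *v p \<and>
            p' = (K ** matrix_inv L) *v q + (K ** matrix_inv L ** matrix_inv M - transpose L) *v p)
       \<and> (\<forall>k. k \<in> T \<longrightarrow> k + 1 \<in> T \<longrightarrow>
            invertible (- matrix_inv L - matrix_inv L ** matrix_inv M ** A k) \<and>
            A (k + 1) =
              (K ** matrix_inv L + (K ** matrix_inv L ** matrix_inv M - transpose L) ** A k)
              ** matrix_inv (- matrix_inv L - matrix_inv L ** matrix_inv M ** A k))"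
proof (intro conjI allI impI)
  fix q p q' p'
  show "left_hamilton_eqs H q p q' p' \<longleftrightarrow>
      q' = (- matrix_inv L) *v q + (- (matrix_inv L ** matrix_inv M)) *v p \<and>
      p' = (K ** matrix_inv L) *v q + (K ** matrix_inv L ** matrix_inv M - transpose L) *v p"
    unfolding H using assms(1,3,4,2) by (rule left_hamilton_eqs_quad_left_hamiltonian)
next
  fix k assume k: "k \<in> T" "k + 1 \<in> T"
  show "invertible (- matrix_inv L - matrix_inv L ** matrix_inv M ** A k)"
    using assms(1,3,2) A_sym[OF k(1)] inv[OF k] by (rule invertible_step_matrix)
  \<comment> \<open>This brings \<open>f\<close> and \<open>HJ\<close> into the affine form required
    by \<open>riccati_step\<close>.\<close>
  have "grad (S k) q = A k *v q + b k" for q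
    unfolding S[OF k(1)] by (rule grad_quad_fun[OF A_sym[OF k(1)]])
  then show "A (k + 1) =
      (K ** matrix_inv L + (K ** matrix_inv L ** matrix_inv M - transpose L) ** A k)
      ** matrix_inv (- matrix_inv L - matrix_inv L ** matrix_inv M ** A k)"
    using f[OF k] HJ[OF k] assms(1-4) A_sym[OF k(1)] A_sym[OF k(2)] inv[OF k]
    unfolding H S[OF k(1)] S[OF k(2)] by (intro riccati_step) simp_all
qed

end
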